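(* Let $q$, $m$, and $r$ be fixed positive integers. For each integer $k\geq 1$ let $\vec{s}(k)=(s_1^k,s_2^k,\ldots,s_r^k)$ be a multi-index of integers $s_1^k,s_2^k,\ldots,s_r^k\geq 3$ (the superscript $k$ is an index, not a power), such that the product $s_1^ks_2^k\cdots s_r^k$ increases as $k$ increases. Then $\{T(\vec{s}(k))\nabla L_{q,m}:k\geq 1\}$ is a self-similar sequence.
   Context: All graphs are finite, undirected, without loops and multiple edges. $|G|$ is the number of vertices of $G$. "Increases" means strictly increases. Two vertices $u,v$ of $G$ are automorphically similar if $\varphi(u)=v$ for some automorphism $\varphi$ of $G$; the equivalence classes $\mathcal O_1,\ldots,\mathcal O_\ell$ are the orbits of $G$. Given an ordering $(\mathcal O_1,\ldots,\mathcal O_\ell)$ of the orbits, the orbit divisor matrix of $G$ is $S_G=[s_{i,j}]_{i,j=1}^{\ell}$, where $s_{i,j}$ is the number of vertices in $\mathcal O_j$ adjacent to a vertex $u\in\mathcal O_i$ (this does not depend on the choice of $u\in\mathcal O_i$). Two connected graphs $G$ and $H$, possibly of different order, are orbitally similar if they have the same number of orbits and $S_G=S_H$ for suitable orderings of the orbits of $G$ and of the orbits of $H$. A sequence $\{G_k:k\geq 1\}$ of connected graphs is self-similar if $|G_1|<|G_2|<|G_3|<\cdots$ and the graphs $G_1,G_2,G_3,\ldots$ are pairwise orbitally similar. $C_n$ is the cycle of order $n$ and $\Box$ is the Cartesian product of graphs. The multi-parametric torus is $T(s_1,\ldots,s_r)=C_{s_1}\Box C_{s_2}\Box\cdots\Box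 C_{s_r}$ (for $r=1$ it is the cycle $C_{s_1}$). $L_{q,m}$ is the rooted graph obtained from $q$ copies of the path $P_{m+1}$ (with $m+1$ vertices, length $m$) by coalescing (identifying) one end-vertex of each copy into a single common vertex, which is the root; it has $1+qm$ vertices. For a graph $G$ and a rooted graph $L$, $G\nabla L$ is the graph obtained by taking, for each vertex $v$ of $G$, a separate copy of $L$ and identifying the root of that copy with $v$. *)

theory Defs
  imports "Graph_Theory.Graph_Theory" "Jordan_Normal_Form.Matrix"
begin

text \<open>
  A finite simple undirected graph is a \<open>pair_graph\<close>: each edge is represented by its two
  opposite arcs.
\<close>

definition connected_graph :: "'a pair_pre_digraph \<Rightarrow> bool" where
  "connected_graph G \<longleftrightarrow> pair_graph G \<and> Digraph_Component.connected (with_proj G)"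

subsection \<open>Automorphisms, orbits and orbital similarity\<close>

definition automorphism :: "'a pair_pre_digraph \<Rightarrow> ('a \<Rightarrow> 'a) \<Rightarrow> bool" where
  "automorphism G \<phi> \<longleftrightarrow> bij_betw \<phi> (pverts G) (pverts G) \<and>
     (\<forall>u\<in>pverts G. \<forall>v\<in>pverts G. (\<phi> u, \<phi> v) \<in> parcs G \<longleftrightarrow> (u, v) \<in> parcs G)"

definition automorphically_similar :: "'a pair_pre_digraph \<Rightarrow> 'a rel" where
  "automorphically_similar G =
     {(u, v). u \<in> pverts G \<and> v \<in> pverts G \<and> (\<exists>\<phi>. automorphism G \<phi> \<and> \<phi> u = v)}"

definition orbits :: "'a pair_pre_digraph \<Rightarrow> 'a set set" where
  "orbits G = pverts G // automorphically_similar G"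

definition orbit_ordering :: "'a pair_pre_digraph \<Rightarrow> 'a set list \<Rightarrow> bool" where
  "orbit_ordering G Os \<longleftrightarrow> distinct Os \<and> set Os = orbits G"

text \<open>The chosen representative of the first orbit is irrelevant, see \<open>orbit_degree_eq\<close> below.\<close>

definition orbit_degree :: "'a pair_pre_digraph \<Rightarrow> 'a set \<Rightarrow> 'a set \<Rightarrow> nat" where
  "orbit_degree G U W = card {v \<in> W. (SOME u. u \<in> U, v) \<in> parcs G}"

definition orbit_divisor_matrix :: "'a pair_pre_digraph \<Rightarrow> 'a set list \<Rightarrow> nat mat" where
  "orbit_divisor_matrix G Os =
     mat (length Os) (length Os) (\<lambda>(i, j). orbit_degree G (Os ! i) (Os ! j))"

definition orbitally_similar :: "'a pair_pre_digraph \<Rightarrow> 'b pair_pre_digraph \<Rightarrow> bool" where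
  "orbitally_similar G H \<longleftrightarrow> card (orbits G) = card (orbits H) \<and>
     (\<exists>Os Ps. orbit_ordering G Os \<and> orbit_ordering H Ps \<and>
        orbit_divisor_matrix G Os = orbit_divisor_matrix H Ps)"

text \<open>Sequences are indexed by the positive integers; the value at index 0 is ignored.\<close>

definition self_similar :: "(nat \<Rightarrow> 'a pair_pre_digraph) \<Rightarrow> bool" where
  "self_similar G \<longleftrightarrow> (\<forall>k\<ge>1. connected_graph (G k)) \<and>
     strict_mono_on {1..} (\<lambda>k. card (pverts (G k))) \<and>
     (\<forall>i\<ge>1. \<forall>j\<ge>1. i \<noteq> j \<longrightarrow> orbitally_similar (G i) (G j))"

lemma automorphism_iff_digraph_isomorphism:
  assumes "pair_wf_digraph G"
  defines "h \<phi> \<equiv> \<lparr>iso_verts = \<phi>, iso_arcs = map_prod \<phi> \<phi>, iso_head = snd, iso_tail = fst\<rparr>"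
  shows "automorphism G \<phi> \<longleftrightarrow>
    pre_digraph.digraph_isomorphism (with_proj G) (h \<phi>) \<and> app_iso (h \<phi>) (with_proj G) = with_proj G"
proof -
  interpret pair_wf_digraph G by fact
  have wf: "wf_digraph (with_proj G)" by unfold_locales
  have sub: "parcs G \<subseteq> pverts G \<times> pverts G" by (auto dest: in_arcsD1 in_arcsD2)
  show ?thesis
  proof
    assume a: "automorphism G \<phi>"
    then have inj: "inj_on \<phi> (pverts G)" and im: "\<phi> ` pverts G = pverts G"
      and e: "\<And>u v. u \<in> pverts G \<Longrightarrow> v \<in> pverts G \<Longrightarrow> (\<phi> u, \<phi> v) \<in> parcs G \<longleftrightarrow> (u, v) \<in> parcs G"
      by (auto simp: automorphism_def bij_betw_def)
    have "inj_on (map_prod \<phi> \<phi>) (parcs G)"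
      using map_prod_inj_on[OF inj inj] sub by (rule inj_on_subset)
    moreover have "map_prod \<phi> \<phi> ` parcs G = parcs G"
    proof
      show "map_prod \<phi> \<phi> ` parcs G \<subseteq> parcs G"
      proof
        fix p assume "p \<in> map_prod \<phi> \<phi> ` parcs G"
        then obtain u v where uv: "(u, v) \<in> parcs G" "p = (\<phi> u, \<phi> v)" by auto
        then show "p \<in> parcs G" using e[OF in_arcsD1[OF uv(1)] in_arcsD2[OF uv(1)]] by simp
      qed
      show "parcs G \<subseteq> map_prod \<phi> \<phi> ` parcs G"
      proof
        fix p assume p: "p \<in> parcs G"
        obtain x y where xy: "p = (x, y)" by (cases p)
        have "x \<in> \<phi> ` pverts G" "y \<in> \<phi> ` pverts G"
          using in_arcsD1 in_arcsD2 p xy by (simp_all only: im)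
        then obtain u v where uv: "u \<in> pverts G" "x = \<phi> u" "v \<in> pverts G" "y = \<phi> v"
          by (elim imageE) simp
        then have "(u, v) \<in> parcs G" using p xy e[OF uv(1) uv(3)] by simp
        moreover have "p = map_prod \<phi> \<phi> (u, v)" using xy uv by simp
        ultimately show "p \<in> map_prod \<phi> \<phi> ` parcs G"
          by (intro image_eqI)
      qed
    qed
    ultimately show "pre_digraph.digraph_isomorphism (with_proj G) (h \<phi>)
        \<and> app_iso (h \<phi>) (with_proj G) = with_proj G"
      using inj im wf
      by (simp add: pre_digraph.digraph_isomorphism_def app_iso_def h_def with_proj_def)
  next
    assume "pre_digraph.digraph_isomorphism (with_proj G) (h \<phi>)
      \<and> app_iso (h \<phi>) (with_proj G) = with_proj G"
    then have inj: "inj_on \<phi> (pverts G)" and im: "\<phi> ` pverts G = pverts G"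
      and ima: "map_prod \<phi> \<phi> ` parcs G = parcs G"
      by (simp_all add: pre_digraph.digraph_isomorphism_def app_iso_def h_def with_proj_def)
    have "(\<phi> u, \<phi> v) \<in> parcs G \<longleftrightarrow> (u, v) \<in> parcs G"
      if u: "u \<in> pverts G" and v: "v \<in> pverts G" for u v
    proof
      assume "(\<phi> u, \<phi> v) \<in> parcs G"
      then have "(\<phi> u, \<phi> v) \<in> map_prod \<phi> \<phi> ` parcs G" by (simp add: ima)
      then obtain x y where xy: "(x, y) \<in> parcs G" "\<phi> u = \<phi> x" "\<phi> v = \<phi> y" by auto
      have "x = u" using inj_onD[OF inj xy(2)] u in_arcsD1[OF xy(1)] by simp
      moreover have "y = v" using inj_onD[OF inj xy(3)] v in_arcsD2[OF xy(1)] by simp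
      ultimately show "(u, v) \<in> parcs G" using xy(1) by simp
    next
      assume "(u, v) \<in> parcs G"
      then have "map_prod \<phi> \<phi> (u, v) \<in> map_prod \<phi> \<phi> ` parcs G" by (rule imageI)
      with ima show "(\<phi> u, \<phi> v) \<in> parcs G" by simp
    qed
    with inj im show "automorphism G \<phi>" unfolding automorphism_def bij_betw_def by blast
  qed
qed

lemma automorphism_id: "automorphism G id"
  by (simp add: automorphism_def)

lemma automorphism_comp:
  "automorphism G \<phi> \<Longrightarrow> automorphism G \<psi> \<Longrightarrow> automorphism G (\<psi> \<circ> \<phi>)"
  unfolding automorphism_def by (auto simp: bij_betw_trans dest: bij_betwE)

lemma automorphism_inv_into:
  assumes "automorphism G \<phi>"
  shows "automorphism G (inv_into (pverts G) \<phi>)"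
proof -
  have b: "bij_betw \<phi> (pverts G) (pverts G)" using assms by (simp add: automorphism_def)
  note c = bij_betw_inv_into[OF b]
  have "(inv_into (pverts G) \<phi> u, inv_into (pverts G) \<phi> v) \<in> parcs G \<longleftrightarrow> (u, v) \<in> parcs G"
    if "u \<in> pverts G" "v \<in> pverts G" for u v
    using assms that bij_betwE[OF c] bij_betw_inv_into_right[OF b]
    unfolding automorphism_def by metis
  with c show ?thesis by (simp add: automorphism_def)
qed

lemma equiv_automorphically_similar: "equiv (pverts G) (automorphically_similar G)"
proof (rule equivI)
  show "automorphically_similar G \<subseteq> pverts G \<times> pverts G"
    by (auto simp: automorphically_similar_def)
  show "refl_on (pverts G) (automorphically_similar G)"
    using automorphism_id by (force simp: refl_on_def automorphically_similar_def)
  show "sym (automorphically_similar G)"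
  proof (rule symI)
    fix u v assume "(u, v) \<in> automorphically_similar G"
    then obtain \<phi> where *: "u \<in> pverts G" "v \<in> pverts G" "automorphism G \<phi>" "\<phi> u = v"
      by (auto simp: automorphically_similar_def)
    then have "inv_into (pverts G) \<phi> v = u"
      by (metis automorphism_def bij_betw_inv_into_left)
    with * automorphism_inv_into show "(v, u) \<in> automorphically_similar G"
      unfolding automorphically_similar_def by blast
  qed
  show "trans (automorphically_similar G)"
  proof (rule transI)
    fix u v w
    assume "(u, v) \<in> automorphically_similar G" "(v, w) \<in> automorphically_similar G"
    then obtain \<phi> \<psi> where *: "u \<in> pverts G" "w \<in> pverts G" "automorphism G \<phi>" "\<phi> u = v"
      "automorphism G \<psi>" "\<psi> v = w"
      by (auto simp: automorphically_similar_def)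
    have "automorphism G (\<psi> \<circ> \<phi>)" "(\<psi> \<circ> \<phi>) u = w"
      using * by (simp_all add: automorphism_comp)
    with * show "(u, w) \<in> automorphically_similar G"
      unfolding automorphically_similar_def by blast
  qed
qed

lemma orbit_degree_eq:
  assumes U: "U \<in> orbits G" and W: "W \<in> orbits G" and u: "u \<in> U"
  shows "orbit_degree G U W = card {v \<in> W. (u, v) \<in> parcs G}"
proof -
  let ?w = "SOME u. u \<in> U"
  note eq = equiv_automorphically_similar[of G]
  have w: "?w \<in> U" using u by (rule someI)
  have "(?w, u) \<in> automorphically_similar G"
    using quotient_eq_iff[OF eq U[unfolded orbits_def] U[unfolded orbits_def] w u] by simp
  then obtain \<phi> where \<phi>: "automorphism G \<phi>" "\<phi> ?w = u" and wV: "?w \<in> pverts G"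
    by (auto simp: automorphically_similar_def)
  then have b: "bij_betw \<phi> (pverts G) (pverts G)"
    and e: "\<And>x y. x \<in> pverts G \<Longrightarrow> y \<in> pverts G \<Longrightarrow> (\<phi> x, \<phi> y) \<in> parcs G \<longleftrightarrow> (x, y) \<in> parcs G"
    by (auto simp: automorphism_def)
  have WV: "W \<subseteq> pverts G"
    using W in_quotient_imp_subset[OF eq] by (simp add: orbits_def)
  have inW: "\<phi> v \<in> W \<longleftrightarrow> v \<in> W" if v: "v \<in> pverts G" for v
  proof -
    have 1: "(v, \<phi> v) \<in> automorphically_similar G"
      using \<phi>(1) bij_betwE[OF b] v unfolding automorphically_similar_def by blast
    moreover have "(\<phi> v, v) \<in> automorphically_similar G"
      using 1 eq by (meson equivE symD)
    ultimately
    show ?thesis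
      using in_quotient_imp_closed[OF eq] W unfolding orbits_def by blast
  qed
  have "bij_betw \<phi> {v \<in> W. (?w, v) \<in> parcs G} {v \<in> W. (u, v) \<in> parcs G}"
  proof (rule bij_betw_imageI)
    show "inj_on \<phi> {v \<in> W. (?w, v) \<in> parcs G}"
      using b WV by (auto simp: bij_betw_def intro: inj_on_subset)
    show "\<phi> ` {v \<in> W. (?w, v) \<in> parcs G} = {v \<in> W. (u, v) \<in> parcs G}"
    proof
      show "\<phi> ` {v \<in> W. (?w, v) \<in> parcs G} \<subseteq> {v \<in> W. (u, v) \<in> parcs G}"
        using WV inW e[OF wV] \<phi>(2) by auto
      show "{v \<in> W. (u, v) \<in> parcs G} \<subseteq> \<phi> ` {v \<in> W. (?w, v) \<in> parcs G}"
      proof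
        fix v assume v: "v \<in> {v \<in> W. (u, v) \<in> parcs G}"
        then obtain x where x: "x \<in> pverts G" "v = \<phi> x"
          using b WV by (auto simp: bij_betw_def)
        then show "v \<in> \<phi> ` {v \<in> W. (?w, v) \<in> parcs G}"
          using v inW e[OF wV] \<phi>(2) by auto
      qed
    qed
  qed
  then show ?thesis unfolding orbit_degree_def by (rule bij_betw_same_card)
qed

subsection \<open>Tori\<close>

definition cycle_graph :: "nat \<Rightarrow> nat pair_pre_digraph" where
  "cycle_graph n = \<lparr>pverts = {..<n},
     parcs = {(i, j). i < n \<and> j < n \<and> (j = Suc i mod n \<or> i = Suc j mod n)}\<rparr>"

text \<open>
  The Cartesian product of a list of graphs; its vertices are lists of vertices. See
  \<open>arcs_cartesian_product_Cons\<close> below for the relation to the binary product.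
\<close>

definition cartesian_product :: "'a pair_pre_digraph list \<Rightarrow> 'a list pair_pre_digraph" where
  "cartesian_product Gs = \<lparr>pverts = {xs. list_all2 (\<lambda>x G. x \<in> pverts G) xs Gs},
     parcs = {(xs, ys). list_all2 (\<lambda>x G. x \<in> pverts G) xs Gs \<and>
       list_all2 (\<lambda>x G. x \<in> pverts G) ys Gs \<and>
       (\<exists>i<length Gs. (xs ! i, ys ! i) \<in> parcs (Gs ! i) \<and>
         (\<forall>j<length Gs. j \<noteq> i \<longrightarrow> xs ! j = ys ! j))}\<rparr>"

definition torus :: "nat list \<Rightarrow> nat list pair_pre_digraph" where
  "torus s = cartesian_product (map cycle_graph s)"

lemma arcs_cartesian_product_Cons:
  assumes "pair_wf_digraph G"
  shows "(x # xs, y # ys) \<in> parcs (cartesian_product (G # Gs)) \<longleftrightarrow>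
    (x, y) \<in> parcs G \<and> xs = ys \<and> xs \<in> pverts (cartesian_product Gs) \<or>
    x = y \<and> x \<in> pverts G \<and> (xs, ys) \<in> parcs (cartesian_product Gs)"
proof -
  interpret pair_wf_digraph G by fact
  let ?adj = "\<lambda>Gs xs ys. \<exists>i<length Gs. (xs ! i, ys ! i) \<in> parcs (Gs ! i) \<and>
    (\<forall>j<length Gs. j \<noteq> i \<longrightarrow> xs ! j = ys ! j)"
  let ?V = "\<lambda>xs Gs. list_all2 (\<lambda>x G. x \<in> pverts G) xs Gs"
  have adj: "?adj (G # Gs) (x # xs) (y # ys) \<longleftrightarrow>
      (x, y) \<in> parcs G \<and> (\<forall>j<length Gs. xs ! j = ys ! j) \<or> x = y \<and> ?adj Gs xs ys"
    (is "?L \<longleftrightarrow> ?R1 \<or> ?R2")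
  proof
    assume ?L
    then obtain i where i: "i < Suc (length Gs)"
        "((x # xs) ! i, (y # ys) ! i) \<in> parcs ((G # Gs) ! i)"
      and eq: "\<And>j. j < Suc (length Gs) \<Longrightarrow> j \<noteq> i \<Longrightarrow> (x # xs) ! j = (y # ys) ! j"
      by auto
    show "?R1 \<or> ?R2"
    proof (cases i)
      case 0
      have "xs ! j = ys ! j" if "j < length Gs" for j using eq[of "Suc j"] that 0 by simp
      with 0 i show ?thesis by simp
    next
      case (Suc k)
      have "xs ! j = ys ! j" if "j < length Gs" "j \<noteq> k" for j using eq[of "Suc j"] that Suc by simp
      moreover have "x = y" using eq[of 0] Suc by simp
      ultimately show ?thesis using i Suc by (intro disjI2 conjI exI[of _ k]) auto
    qed
  next
    assume "?R1 \<or> ?R2"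
    then show ?L
    proof
      assume ?R1
      then show ?L by (intro exI[of _ 0]) (auto simp: nth_Cons')
    next
      assume ?R2
      then obtain k where "x = y" "k < length Gs" "(xs ! k, ys ! k) \<in> parcs (Gs ! k)"
        "\<forall>j<length Gs. j \<noteq> k \<longrightarrow> xs ! j = ys ! j" by blast
      then show ?L by (intro exI[of _ "Suc k"]) (auto simp: nth_Cons')
    qed
  qed
  have eq: "(\<forall>j<length Gs. xs ! j = ys ! j) \<longleftrightarrow> xs = ys" if "?V xs Gs" "?V ys Gs"
    using that by (auto simp: list_eq_iff_nth_eq dest!: list_all2_lengthD)
  have "(x # xs, y # ys) \<in> parcs (cartesian_product (G # Gs)) \<longleftrightarrow>
      (x \<in> pverts G \<and> ?V xs Gs) \<and> (y \<in> pverts G \<and> ?V ys Gs) \<and> ?adj (G # Gs) (x # xs) (y # ys)"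
    unfolding cartesian_product_def by simp
  also have "\<dots> \<longleftrightarrow> (x, y) \<in> parcs G \<and> xs = ys \<and> ?V xs Gs \<or>
      x = y \<and> x \<in> pverts G \<and> ?V xs Gs \<and> ?V ys Gs \<and> ?adj Gs xs ys"
    unfolding adj using eq in_arcsD1[of x y] in_arcsD2[of x y] by blast
  also have "\<dots> \<longleftrightarrow> (x, y) \<in> parcs G \<and> xs = ys \<and> xs \<in> pverts (cartesian_product Gs) \<or>
      x = y \<and> x \<in> pverts G \<and> (xs, ys) \<in> parcs (cartesian_product Gs)"
    unfolding cartesian_product_def by simp
  finally show ?thesis .
qed

subsection \<open>Rooted graphs\<close>

record 'a rooted_graph = "'a pair_pre_digraph" +
  the_root :: 'a

definition rooted_path :: "nat \<Rightarrow> nat rooted_graph" where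
  "rooted_path n = \<lparr>pverts = {..<n},
     parcs = {(i, j). i < n \<and> j < n \<and> (j = Suc i \<or> i = Suc j)}, the_root = 0\<rparr>"

text \<open>
  \<open>coalesce q L\<close> is obtained from the disjoint copies \<open>{i} \<times> L\<close>, \<open>i < q\<close>, of a rooted graph \<open>L\<close>
  by identifying all the roots with a single vertex \<open>None\<close>; it is the image of the disjoint union
  under the identification map \<open>coalesce_map\<close>.
\<close>

definition coalesce_map :: "('a, 'z) rooted_graph_scheme \<Rightarrow> nat \<Rightarrow> 'a \<Rightarrow> (nat \<times> 'a) option" where
  "coalesce_map L i x = (if x = the_root L then None else Some (i, x))"

definition coalesce :: "nat \<Rightarrow> 'a rooted_graph \<Rightarrow> (nat \<times> 'a) option rooted_graph" where
  "coalesce q L = \<lparr>pverts = (\<Union>i<q. coalesce_map L i ` pverts L),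
     parcs = (\<Union>i<q. map_prod (coalesce_map L i) (coalesce_map L i) ` parcs L),
     the_root = None\<rparr>"

text \<open>The rooted graph \<open>L\<^sub>q\<^sub>,\<^sub>m\<close>; \<open>rooted_path (m + 1)\<close> has \<open>m + 1\<close> vertices.\<close>

definition coalesced_paths :: "nat \<Rightarrow> nat \<Rightarrow> (nat \<times> nat) option rooted_graph" where
  "coalesced_paths q m = coalesce q (rooted_path (m + 1))"

text \<open>
  In \<open>G \<nabla> L\<close> the vertices \<open>(v, x)\<close>, with \<open>v\<close> fixed, form the copy of \<open>L\<close> attached at \<open>v\<close>, and the
  vertex \<open>v\<close> of \<open>G\<close> itself is identified with the root \<open>(v, the_root L)\<close> of that copy.
\<close>

definition attach_copies ::
    "'a pair_pre_digraph \<Rightarrow> 'b rooted_graph \<Rightarrow> ('a \<times> 'b) pair_pre_digraph"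
    (infixl \<open>\<nabla>\<close> 70) where
  "G \<nabla> L = \<lparr>pverts = pverts G \<times> pverts L,
     parcs = {((v, the_root L), (w, the_root L)) | v w. (v, w) \<in> parcs G} \<union>
       {((v, x), (v, y)) | v x y. v \<in> pverts G \<and> (x, y) \<in> parcs L}\<rparr>"

lemma card_coalesced_paths:
  assumes "q \<ge> 1"
  shows "card (pverts (coalesced_paths q m)) = 1 + q * m"
proof -
  have "pverts (coalesced_paths q m) = insert None (Some ` ({..<q} \<times> {1..m}))"
  proof (intro equalityI subsetI)
    fix z assume "z \<in> pverts (coalesced_paths q m)"
    then show "z \<in> insert None (Some ` ({..<q} \<times> {1..m}))"
      by (auto simp: coalesced_paths_def coalesce_def coalesce_map_def rooted_path_def
          split: if_splits)
  next
    fix z :: "(nat \<times> nat) option" assume z: "z \<in> insert None (Some ` ({..<q} \<times> {1..m}))"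
    have mem: "coalesce_map (rooted_path (m + 1)) i j \<in> pverts (coalesced_paths q m)"
      if "i < q" "j \<le> m" for i j
    proof -
      have "j \<in> pverts (rooted_path (m + 1))" using that by (simp add: rooted_path_def)
      then show ?thesis using that(1) by (auto simp: coalesced_paths_def coalesce_def)
    qed
    from z consider "z = None" | i j where "i < q" "1 \<le> j" "j \<le> m" "z = Some (i, j)" by auto
    then show "z \<in> pverts (coalesced_paths q m)"
    proof cases
      case 1
      then show ?thesis using mem[of 0 0] assms by (simp add: coalesce_map_def rooted_path_def)
    next
      case (2 i j)
      then show ?thesis using mem[of i j] by (simp add: coalesce_map_def rooted_path_def)
    qed
  qed
  moreover have "card (Some ` ({..<q} \<times> {1..m})) = q * m"
    by (simp add: card_image card_cartesian_product)
  ultimately show ?thesis by (simp add: card_insert_if image_iff)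
qed

end

theory Submission
  imports Defs "HOL-Number_Theory.Cong" "HOL-Combinatorics.Transposition"
begin

text \<open>
  The orbits of \<open>T \<nabla> L\<^sub>q\<^sub>,\<^sub>m\<close>, for a torus \<open>T\<close>, are the \<open>m + 1\<close> levels formed by the vertices at a
  given distance from \<open>T\<close>. Translations of the torus, extended to all the attached copies, together
  with permutations of the \<open>q\<close> paths act transitively on each level. Conversely every automorphism
  preserves the levels: a vertex of \<open>T\<close> has degree at least 3 and every other vertex has degree at
  most 2, so level 0 is preserved, and an induction along the paths gives the rest. The numbers of
  neighbours between levels depend only on \<open>q\<close>, \<open>m\<close> and the degree \<open>2r\<close> of the torus.
\<close>

section \<open>Finite simple graphs as relations: walks and automorphisms\<close>

lemma pair_graph_iff:
  "pair_graph G \<longleftrightarrow> finite (pverts G) \<and> parcs G \<subseteq> pverts G \<times> pverts G \<and>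
     sym (parcs G) \<and> irrefl (parcs G)"
proof
  assume "pair_graph G"
  then interpret pair_graph G .
  have "irrefl (parcs G)" by (rule irreflI) (use no_loops' in blast)
  then show "finite (pverts G) \<and> parcs G \<subseteq> pverts G \<times> pverts G \<and> sym (parcs G) \<and> irrefl (parcs G)"
    using pair_finite_verts in_arcsD1 in_arcsD2 pair_sym_arcs by (auto simp: symmetric_def)
next
  assume *: "finite (pverts G) \<and> parcs G \<subseteq> pverts G \<times> pverts G \<and> sym (parcs G) \<and> irrefl (parcs G)"
  then have "finite (parcs G)" by (meson finite_SigmaI finite_subset)
  then show "pair_graph G"
    using * by unfold_locales (auto simp: symmetric_def irrefl_def)
qed

text \<open>Library connectedness is strong connectedness of the symmetric closure and includes
  having a vertex. Walks in \<open>(parcs G)\<^sup>*\<close> become library reachability and then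
  lift to that closure.\<close>

lemma connected_graphI:
  assumes "pair_graph G" and "pverts G \<noteq> {}" and "pverts G \<times> pverts G \<subseteq> (parcs G)\<^sup>*"
  shows "connected_graph G"
proof -
  interpret pair_graph G by fact
  have "u \<rightarrow>\<^sup>*\<^bsub>with_proj G\<^esub> v" if "u \<in> pverts G" "v \<in> pverts G" for u v
  proof -
    have "(u, v) \<in> (parcs G)\<^sup>*" using assms(3) that by blast
    then show ?thesis
      using that by (induction rule: converse_rtrancl_induct)
        (auto dest: in_arcsD1 in_arcsD2 intro: adj_reachable_trans)
  qed
  then show ?thesis
    using assms(1,2) reachable_mk_symmetricI
    by (auto simp: connected_graph_def Digraph_Component.connected_def strongly_connected_def)
qed

text \<open>Arc-preserving maps carry walks to walks. Used below to embed a factor into a product,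
  and \<open>G\<close> or a copy of \<open>L\<close> into \<open>G \<nabla> L\<close>.\<close>

lemma rtrancl_map:
  assumes "\<And>x y. (x, y) \<in> R \<Longrightarrow> (f x, f y) \<in> S" and "(x, y) \<in> R\<^sup>*"
  shows "(f x, f y) \<in> S\<^sup>*"
  using assms(2) by induction (auto intro: rtrancl_into_rtrancl assms(1))

lemma rtrancl_all_pairsI:
  assumes "sym R" and "\<And>v. v \<in> V \<Longrightarrow> (w, v) \<in> R\<^sup>*"
  shows "V \<times> V \<subseteq> R\<^sup>*"
  using assms by (auto intro: rtrancl_trans dest: symD[OF sym_rtrancl])

text \<open>An injective self-map of a finite set is onto, so surjectivity comes for free.\<close>

lemma automorphismI:
  assumes "finite (pverts G)" and "\<phi> ` pverts G \<subseteq> pverts G" and "inj_on \<phi> (pverts G)"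
    and "\<And>u v. u \<in> pverts G \<Longrightarrow> v \<in> pverts G \<Longrightarrow> (\<phi> u, \<phi> v) \<in> parcs G \<longleftrightarrow> (u, v) \<in> parcs G"
  shows "automorphism G \<phi>"
  using assms endo_inj_surj[OF assms(1-3)] by (simp add: automorphism_def bij_betw_def)

text \<open>The automorphism restricts to a bijection between the two neighbourhoods. This degree
  invariance will separate torus vertices from path vertices.\<close>

lemma card_neighbours_automorphism:
  assumes "pair_graph G" and "automorphism G \<phi>" and "u \<in> pverts G"
  shows "card {w. (\<phi> u, w) \<in> parcs G} = card {w. (u, w) \<in> parcs G}"
proof -
  have sub: "parcs G \<subseteq> pverts G \<times> pverts G" using assms(1) by (simp add: pair_graph_iff)
  have inj: "inj_on \<phi> (pverts G)" and im: "\<phi> ` pverts G = pverts G"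
    and e: "\<And>x y. x \<in> pverts G \<Longrightarrow> y \<in> pverts G \<Longrightarrow> (\<phi> x, \<phi> y) \<in> parcs G \<longleftrightarrow> (x, y) \<in> parcs G"
    using assms(2) by (auto simp: automorphism_def bij_betw_def)
  have "{w. (\<phi> u, w) \<in> parcs G} = \<phi> ` {w. (u, w) \<in> parcs G}"
  proof (intro equalityI subsetI)
    fix w assume w: "w \<in> {w. (\<phi> u, w) \<in> parcs G}"
    then have "w \<in> \<phi> ` pverts G" using sub im by auto
    with w e[OF assms(3)] show "w \<in> \<phi> ` {w. (u, w) \<in> parcs G}" by auto
  next
    fix w assume "w \<in> \<phi> ` {w. (u, w) \<in> parcs G}"
    then show "w \<in> {w. (\<phi> u, w) \<in> parcs G}" using e[OF assms(3)] sub by auto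
  qed
  moreover have "inj_on \<phi> {w. (u, w) \<in> parcs G}" using inj sub by (auto intro: inj_on_subset)
  ultimately show ?thesis by (simp add: card_image)
qed

subsection \<open>Cartesian products\<close>

lemma cartesian_product_Nil:
  "pverts (cartesian_product []) = {[]}" "parcs (cartesian_product []) = {}"
  by (auto simp: cartesian_product_def)

lemma pverts_cartesian_product_Cons:
  "pverts (cartesian_product (G # Gs)) =
     (\<lambda>(x, xs). x # xs) ` (pverts G \<times> pverts (cartesian_product Gs))"
  by (auto simp: cartesian_product_def list_all2_Cons2)

lemma parcs_cartesian_product_subset:
  "parcs (cartesian_product Gs) \<subseteq> pverts (cartesian_product Gs) \<times> pverts (cartesian_product Gs)"
  by (auto simp: cartesian_product_def)

lemma pair_graph_cartesian_product:
  "(\<And>G. G \<in> set Gs \<Longrightarrow> pair_graph G) \<Longrightarrow> pair_graph (cartesian_product Gs)"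
proof (induction Gs)
  case Nil
  then show ?case by (simp add: pair_graph_iff cartesian_product_Nil sym_def irrefl_def)
next
  case (Cons G Gs)
  let ?P = "cartesian_product (G # Gs)"
  interpret pair_graph G using Cons.prems by simp
  have G: "pair_graph G" and H: "pair_graph (cartesian_product Gs)" using Cons by simp_all
  have fin: "finite (pverts ?P)"
    using G H by (auto simp: pair_graph_iff pverts_cartesian_product_Cons)
  have arc: "\<exists>x xs y ys. u = x # xs \<and> v = y # ys" if "(u, v) \<in> parcs ?P" for u v
    using that parcs_cartesian_product_subset[of "G # Gs"]
    by (auto simp: pverts_cartesian_product_Cons)
  note c = arcs_cartesian_product_Cons[OF pair_wf_digraph]
  have "sym (parcs ?P)"
  proof (rule symI)
    fix u v assume uv: "(u, v) \<in> parcs ?P"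
    then obtain x xs y ys where "u = x # xs" "v = y # ys" using arc by blast
    with uv show "(v, u) \<in> parcs ?P"
      using G H by (auto simp: c pair_graph_iff dest: symD)
  qed
  moreover have "irrefl (parcs ?P)"
  proof (rule irreflI)
    fix u show "(u, u) \<notin> parcs ?P"
    proof
      assume uu: "(u, u) \<in> parcs ?P"
      then obtain x xs where "u = x # xs" using arc by blast
      with uu show False using G H by (auto simp: c pair_graph_iff irrefl_def)
    qed
  qed
  ultimately show ?case
    using fin parcs_cartesian_product_subset[of "G # Gs"] by (simp add: pair_graph_iff)
qed

text \<open>Induction on the factors: first move the head along a walk of \<open>G\<close> with the
  tail fixed, then move the tail.\<close>

lemma rtrancl_cartesian_product:
  assumes "\<And>G. G \<in> set Gs \<Longrightarrow> pair_graph G"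
    and "\<And>G. G \<in> set Gs \<Longrightarrow> pverts G \<times> pverts G \<subseteq> (parcs G)\<^sup>*"
  shows "pverts (cartesian_product Gs) \<times> pverts (cartesian_product Gs) \<subseteq>
     (parcs (cartesian_product Gs))\<^sup>*"
  using assms
proof (induction Gs)
  case Nil
  then show ?case by (simp add: cartesian_product_Nil)
next
  case (Cons G Gs)
  let ?R = "parcs (cartesian_product (G # Gs))"
  interpret pair_graph G using Cons.prems by simp
  note c = arcs_cartesian_product_Cons[OF pair_wf_digraph]
  have "(x # xs, y # ys) \<in> ?R\<^sup>*"
    if V: "x \<in> pverts G" "y \<in> pverts G" "xs \<in> pverts (cartesian_product Gs)"
      "ys \<in> pverts (cartesian_product Gs)" for x xs y ys
  proof -
    have "(x, y) \<in> (parcs G)\<^sup>*" using Cons.prems(2)[of G] V by auto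
    then have 1: "(x # xs, y # xs) \<in> ?R\<^sup>*"
      by (rule rtrancl_map[rotated]) (simp add: c V)
    have "(xs, ys) \<in> (parcs (cartesian_product Gs))\<^sup>*" using Cons V by auto
    then have "(y # xs, y # ys) \<in> ?R\<^sup>*"
      by (rule rtrancl_map[rotated]) (simp add: c V)
    with 1 show ?thesis by (rule rtrancl_trans)
  qed
  then show ?case by (auto simp: pverts_cartesian_product_Cons)
qed

text \<open>Automorphisms of the factors act coordinatewise on the product; choosing one per factor
  moves any vertex to any other.\<close>

lemma vertex_transitive_cartesian_product:
  assumes "\<And>G. G \<in> set Gs \<Longrightarrow> pair_graph G"
    and "\<And>G. G \<in> set Gs \<Longrightarrow> automorphically_similar G = pverts G \<times> pverts G"
  shows "automorphically_similar (cartesian_product Gs) =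
     pverts (cartesian_product Gs) \<times> pverts (cartesian_product Gs)"
  using assms
proof (induction Gs)
  case Nil
  have "automorphism (cartesian_product []) id" by (rule automorphism_id)
  then show ?case by (auto simp: automorphically_similar_def cartesian_product_Nil)
next
  case (Cons G Gs)
  let ?P = "cartesian_product (G # Gs)" and ?Q = "cartesian_product Gs"
  interpret pair_graph G using Cons.prems by simp
  note c = arcs_cartesian_product_Cons[OF pair_wf_digraph]
  have finP: "finite (pverts ?P)"
    using pair_graph_cartesian_product[of "G # Gs"] Cons.prems(1) by (simp add: pair_graph_iff)
  have "(x # xs, y # ys) \<in> automorphically_similar ?P"
    if V: "x \<in> pverts G" "y \<in> pverts G" "xs \<in> pverts ?Q" "ys \<in> pverts ?Q" for x xs y ys
  proof -
    have "(x, y) \<in> automorphically_similar G" using Cons.prems(2)[of G] V by auto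
    then obtain f where f: "automorphism G f" "f x = y" by (auto simp: automorphically_similar_def)
    have "(xs, ys) \<in> automorphically_similar ?Q" using Cons V by auto
    then obtain g where g: "automorphism ?Q g" "g xs = ys"
      by (auto simp: automorphically_similar_def)
    have f': "inj_on f (pverts G)" "f ` pverts G = pverts G"
      "\<And>u v. u \<in> pverts G \<Longrightarrow> v \<in> pverts G \<Longrightarrow> (f u, f v) \<in> parcs G \<longleftrightarrow> (u, v) \<in> parcs G"
      using f(1) by (auto simp: automorphism_def bij_betw_def)
    have g': "inj_on g (pverts ?Q)" "g ` pverts ?Q = pverts ?Q"
      "\<And>u v. u \<in> pverts ?Q \<Longrightarrow> v \<in> pverts ?Q \<Longrightarrow> (g u, g v) \<in> parcs ?Q \<longleftrightarrow> (u, v) \<in> parcs ?Q"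
      using g(1) by (auto simp: automorphism_def bij_betw_def)
    let ?h = "\<lambda>zs. f (hd zs) # g (tl zs)"
    have "automorphism ?P ?h"
    proof (rule automorphismI[OF finP])
      show "?h ` pverts ?P \<subseteq> pverts ?P"
        using equalityD1[OF f'(2)] equalityD1[OF g'(2)]
        by (force simp: pverts_cartesian_product_Cons)
      \<comment> \<open>Injectivity of \<open>f\<close> and \<open>g\<close> also matters for arcs
        below: adjacency demands equality in the unchanged coordinates, which must be reflected as
        well as preserved.\<close>
      show "inj_on ?h (pverts ?P)"
        using f'(1) g'(1) by (auto simp: pverts_cartesian_product_Cons inj_on_def)
      fix u v assume "u \<in> pverts ?P" "v \<in> pverts ?P"
      then show "(?h u, ?h v) \<in> parcs ?P \<longleftrightarrow> (u, v) \<in> parcs ?P"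
        using f' g' by (auto simp: pverts_cartesian_product_Cons c inj_on_eq_iff)
    qed
    moreover have "?h (x # xs) = y # ys" using f g by simp
    moreover have "x # xs \<in> pverts ?P" "y # ys \<in> pverts ?P"
      using V by (auto simp: pverts_cartesian_product_Cons)
    ultimately show ?thesis unfolding automorphically_similar_def by blast
  qed
  then have "pverts ?P \<times> pverts ?P \<subseteq> automorphically_similar ?P"
    by (auto simp: pverts_cartesian_product_Cons)
  then show ?case by (auto simp: automorphically_similar_def)
qed

text \<open>A neighbour changes either the head, in \<open>d\<close> ways, or exactly one coordinate
  of the tail, counted by induction.\<close>

lemma card_neighbours_cartesian_product:
  assumes "\<And>G. G \<in> set Gs \<Longrightarrow> pair_graph G"
    and "\<And>G v. G \<in> set Gs \<Longrightarrow> v \<in> pverts G \<Longrightarrow> card {w. (v, w) \<in> parcs G} = d"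
    and "xs \<in> pverts (cartesian_product Gs)"
  shows "card {ys. (xs, ys) \<in> parcs (cartesian_product Gs)} = length Gs * d"
  using assms
proof (induction Gs arbitrary: xs)
  case Nil
  then show ?case by (simp add: cartesian_product_Nil)
next
  case (Cons G Gs)
  let ?P = "cartesian_product (G # Gs)" and ?Q = "cartesian_product Gs"
  interpret pair_graph G using Cons.prems by simp
  note c = arcs_cartesian_product_Cons[OF pair_wf_digraph]
  obtain z zs where xs: "xs = z # zs" "z \<in> pverts G" "zs \<in> pverts ?Q"
    using Cons.prems(3) by (auto simp: pverts_cartesian_product_Cons)
  let ?A = "(\<lambda>y. y # zs) ` {y. (z, y) \<in> parcs G}" and ?B = "(#) z ` {ys. (zs, ys) \<in> parcs ?Q}"
  have "{ys. (xs, ys) \<in> parcs ?P} = ?A \<union> ?B"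
  proof (intro equalityI subsetI)
    fix us assume us: "us \<in> {ys. (xs, ys) \<in> parcs ?P}"
    then have "us \<in> pverts ?P" using parcs_cartesian_product_subset by blast
    then obtain y ys where "us = y # ys" by (auto simp: pverts_cartesian_product_Cons)
    with us xs show "us \<in> ?A \<union> ?B" by (auto simp: c)
  qed (use xs in \<open>auto simp: c\<close>)
  \<comment> \<open>A common element would have head \<open>z\<close> and so give a loop at
    \<open>z\<close> in \<open>G\<close>.\<close>
  moreover have "finite ?A" "?A \<inter> ?B = {}"
    using no_loops' finite_subset[OF _ pair_finite_verts, of "{y. (z, y) \<in> parcs G}"]
    by (auto dest: in_arcsD2)
  moreover have "finite ?B"
    using pair_graph_cartesian_product[of Gs] Cons.prems(1) parcs_cartesian_product_subset[of Gs]
      finite_subset[of "{ys. (zs, ys) \<in> parcs ?Q}" "pverts ?Q"]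
    by (auto simp: pair_graph_iff)
  moreover have "card ?A = d" "card ?B = length Gs * d"
    using Cons xs by (simp_all add: card_image inj_on_def)
  ultimately show ?case by (simp add: card_Un_disjoint)
qed

lemma card_pverts_cartesian_product:
  "card (pverts (cartesian_product Gs)) = prod_list (map (\<lambda>G. card (pverts G)) Gs)"
proof (induction Gs)
  case (Cons G Gs)
  have "inj_on (\<lambda>(x, xs). x # xs) (pverts G \<times> pverts (cartesian_product Gs))"
    by (auto simp: inj_on_def)
  with Cons show ?case by (simp add: pverts_cartesian_product_Cons card_image card_cartesian_product)
qed (simp add: cartesian_product_Nil)

subsection \<open>Tori\<close>

lemma pair_graph_cycle_graph:
  assumes "n \<ge> 3"
  shows "pair_graph (cycle_graph n)"
proof -
  have "i \<noteq> Suc i mod n" if "i < n" for i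
    using assms that by (simp add: mod_Suc)
  then show ?thesis
    by (auto simp: pair_graph_iff cycle_graph_def sym_def irrefl_def)
qed

lemma rtrancl_cycle_graph:
  assumes "n \<ge> 3"
  shows "pverts (cycle_graph n) \<times> pverts (cycle_graph n) \<subseteq> (parcs (cycle_graph n))\<^sup>*"
proof (rule rtrancl_all_pairsI)
  show "sym (parcs (cycle_graph n))"
    using pair_graph_cycle_graph[OF assms] by (simp add: pair_graph_iff)
  \<comment> \<open>Counting up from 0 never wraps around, so the modulus plays no part in this
    walk.\<close>
  have "i < n \<Longrightarrow> (0, i) \<in> (parcs (cycle_graph n))\<^sup>*" for i
  proof (induction i)
    case (Suc i)
    then have "(i, Suc i) \<in> parcs (cycle_graph n)" by (simp add: cycle_graph_def)
    with Suc show ?case by (meson Suc_lessD rtrancl.rtrancl_into_rtrancl)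
  qed simp
  then show "(0, v) \<in> (parcs (cycle_graph n))\<^sup>*" if "v \<in> pverts (cycle_graph n)" for v
    using that by (simp add: cycle_graph_def)
qed

lemma vertex_transitive_cycle_graph:
  assumes "n \<ge> 3"
  shows "automorphically_similar (cycle_graph n) = pverts (cycle_graph n) \<times> pverts (cycle_graph n)"
proof -
  \<comment> \<open>Rotations are automorphisms: adding \<open>k\<close> modulo \<open>n\<close> is
    injective on residues (\<open>cancel\<close>) and respects the successor relation
    (\<open>step\<close>).\<close>
  have cancel: "(a + k) mod n = (b + k) mod n \<longleftrightarrow> a mod n = b mod n" for a b k :: nat
    using cong_add_rcancel_nat[of a k b n] by (simp add: cong_def)
  have step: "(j + k) mod n = Suc ((i + k) mod n) mod n \<longleftrightarrow> j = Suc i mod n" if "j < n" for i j k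
    using cancel[of j k "Suc i"] that by (simp add: mod_Suc_eq)
  have "(i, j) \<in> automorphically_similar (cycle_graph n)" if ij: "i < n" "j < n" for i j
  proof -
    \<comment> \<open>Rotation by \<open>j - i\<close>, raised by \<open>n\<close> to stay in the
      naturals.\<close>
    let ?\<phi> = "\<lambda>x. (x + (n - i + j)) mod n"
    have "automorphism (cycle_graph n) ?\<phi>"
      by (rule automorphismI)
        (use assms in \<open>auto simp: cycle_graph_def inj_on_def step cancel\<close>)
    moreover have "?\<phi> i = j" using ij by simp
    ultimately show ?thesis using ij by (force simp: automorphically_similar_def cycle_graph_def)
  qed
  then have "pverts (cycle_graph n) \<times> pverts (cycle_graph n) \<subseteq> automorphically_similar (cycle_graph n)"
    by (auto simp: cycle_graph_def)
  then show ?thesis by (auto simp: automorphically_similar_def)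
qed

lemma card_neighbours_cycle_graph:
  assumes "n \<ge> 3" and "i \<in> pverts (cycle_graph n)"
  shows "card {j. (i, j) \<in> parcs (cycle_graph n)} = 2"
proof -
  have i: "i < n" using assms(2) by (simp add: cycle_graph_def)
  \<comment> \<open>The cyclic predecessor of \<open>i\<close>; it differs from the successor
    because \<open>n \<ge> 3\<close>.\<close>
  let ?p = "if i = 0 then n - 1 else i - 1"
  have "{j. (i, j) \<in> parcs (cycle_graph n)} = {Suc i mod n, ?p}"
    using i assms(1) by (auto simp: cycle_graph_def mod_Suc split: if_splits)
  moreover have "Suc i mod n \<noteq> ?p" using i assms(1) by (auto simp: mod_Suc)
  ultimately show ?thesis by simp
qed

lemma card_pverts_torus: "card (pverts (torus s)) = prod_list s"
  by (simp add: torus_def card_pverts_cartesian_product comp_def cycle_graph_def)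

lemma
  assumes "\<And>n. n \<in> set s \<Longrightarrow> n \<ge> 3"
  shows pair_graph_torus: "pair_graph (torus s)"
    and rtrancl_torus: "pverts (torus s) \<times> pverts (torus s) \<subseteq> (parcs (torus s))\<^sup>*"
    and vertex_transitive_torus:
      "automorphically_similar (torus s) = pverts (torus s) \<times> pverts (torus s)"
    and card_neighbours_torus:
      "v \<in> pverts (torus s) \<Longrightarrow> card {w. (v, w) \<in> parcs (torus s)} = length s * 2"
proof -
  have G: "\<exists>n\<ge>3. G = cycle_graph n" if "G \<in> set (map cycle_graph s)" for G
    using that assms by auto
  note [intro] = pair_graph_cycle_graph
  show "pair_graph (torus s)"
    unfolding torus_def by (rule pair_graph_cartesian_product) (use G in blast)
  show "pverts (torus s) \<times> pverts (torus s) \<subseteq> (parcs (torus s))\<^sup>*"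
    unfolding torus_def
    by (rule rtrancl_cartesian_product) (use G rtrancl_cycle_graph in blast)+
  show "automorphically_similar (torus s) = pverts (torus s) \<times> pverts (torus s)"
    unfolding torus_def
    by (rule vertex_transitive_cartesian_product) (use G vertex_transitive_cycle_graph in blast)+
  show "card {w. (v, w) \<in> parcs (torus s)} = length s * 2" if "v \<in> pverts (torus s)"
    using card_neighbours_cartesian_product[of "map cycle_graph s" 2 v] that G
      card_neighbours_cycle_graph by (force simp: torus_def)
qed

subsection \<open>Attaching copies of a rooted graph\<close>

lemma pverts_attach_copies: "pverts (G \<nabla> L) = pverts G \<times> pverts L"
  by (simp add: attach_copies_def)

lemma parcs_attach_copies:
  "((v, x), (w, y)) \<in> parcs (G \<nabla> L) \<longleftrightarrow>
     x = the_root L \<and> y = the_root L \<and> (v, w) \<in> parcs G \<or>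
     v = w \<and> v \<in> pverts G \<and> (x, y) \<in> parcs L"
  by (auto simp: attach_copies_def)

text \<open>\<open>truncate\<close> forgets the root, so that a rooted graph can be treated as a
  plain graph.\<close>

lemma pair_graph_attach_copies:
  assumes "pair_graph G" and "pair_graph (pair_pre_digraph.truncate L)" and "the_root L \<in> pverts L"
  shows "pair_graph (G \<nabla> L)"
  using assms unfolding pair_graph_iff
  by (auto simp: pverts_attach_copies parcs_attach_copies pair_pre_digraph.truncate_def
      intro!: symI irreflI dest: symD irreflD)

text \<open>Walk to the root of the first copy, across \<open>G\<close> through the roots, then out
  into the second copy.\<close>

lemma rtrancl_attach_copies:
  assumes "the_root L \<in> pverts L" and "pverts G \<times> pverts G \<subseteq> (parcs G)\<^sup>*"
    and "pverts L \<times> pverts L \<subseteq> (parcs L)\<^sup>*"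
  shows "pverts (G \<nabla> L) \<times> pverts (G \<nabla> L) \<subseteq> (parcs (G \<nabla> L))\<^sup>*"
proof -
  have copy: "((v, x), (v, y)) \<in> (parcs (G \<nabla> L))\<^sup>*"
    if "v \<in> pverts G" "x \<in> pverts L" "y \<in> pverts L" for v x y
    using assms(3) that
    by (intro rtrancl_map[of "parcs L" "Pair v"]) (auto simp: parcs_attach_copies)
  have base: "((v, the_root L), (w, the_root L)) \<in> (parcs (G \<nabla> L))\<^sup>*"
    if "v \<in> pverts G" "w \<in> pverts G" for v w
    using assms(2) that
    by (intro rtrancl_map[of "parcs G" "\<lambda>v. (v, the_root L)"]) (auto simp: parcs_attach_copies)
  have "((v, x), (w, y)) \<in> (parcs (G \<nabla> L))\<^sup>*"
    if "v \<in> pverts G" "w \<in> pverts G" "x \<in> pverts L" "y \<in> pverts L" for v w x y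
    using copy[OF that(1,3) assms(1)] base[OF that(1,2)] copy[OF that(2) assms(1) that(4)]
    by (meson rtrancl_trans)
  then show ?thesis by (auto simp: pverts_attach_copies)
qed

text \<open>Arcs of \<open>G\<close> join roots only. Since \<open>\<psi>\<close> fixes the root and
  is injective, no other vertex is sent to the root, so these arcs are preserved and
  reflected.\<close>

lemma automorphism_attach_copies:
  assumes "automorphism G \<phi>" and "automorphism (pair_pre_digraph.truncate L) \<psi>"
    and "the_root L \<in> pverts L" and "\<psi> (the_root L) = the_root L"
  shows "automorphism (G \<nabla> L) (map_prod \<phi> \<psi>)"
proof -
  have "inj_on \<phi> (pverts G)" "inj_on \<psi> (pverts L)"
    using assms(1,2) by (auto simp: automorphism_def bij_betw_def pair_pre_digraph.truncate_def)
  moreover have "bij_betw (map_prod \<phi> \<psi>) (pverts (G \<nabla> L)) (pverts (G \<nabla> L))"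
    using assms(1,2) by (simp add: automorphism_def bij_betw_def pverts_attach_copies
        pair_pre_digraph.truncate_def map_prod_inj_on map_prod_surj_on)
  moreover have "\<psi> x = the_root L \<longleftrightarrow> x = the_root L" if "x \<in> pverts L" for x
    using inj_onD[OF calculation(2), of x "the_root L"] assms(3,4) that by auto
  ultimately show ?thesis
    using assms(1,2)
    by (auto simp: automorphism_def pverts_attach_copies parcs_attach_copies
        pair_pre_digraph.truncate_def inj_on_eq_iff dest: bij_betwE)
qed

subsection \<open>Coalesced paths\<close>

text \<open>Uniform coordinates: \<open>spoke i a\<close> is the vertex at distance \<open>a\<close>
  from the root on path \<open>i\<close>. All paths share the value \<open>None\<close> at
  \<open>a = 0\<close>.\<close>

definition spoke :: "nat \<Rightarrow> nat \<Rightarrow> (nat \<times> nat) option" where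
  "spoke i a = (if a = 0 then None else Some (i, a))"

definition depth :: "(nat \<times> nat) option \<Rightarrow> nat" where
  "depth x = (case x of None \<Rightarrow> 0 | Some (i, a) \<Rightarrow> a)"

lemma spoke_0: "spoke i 0 = None"
  by (simp add: spoke_def)

lemma depth_spoke [simp]: "depth (spoke i a) = a"
  by (simp add: spoke_def depth_def)

lemma spoke_eq_iff: "spoke i a = spoke j b \<longleftrightarrow> a = b \<and> (i = j \<or> a = 0)"
  by (auto simp: spoke_def)

lemma coalesce_map_rooted_path: "coalesce_map (rooted_path n) i = spoke i"
  by (auto simp: coalesce_map_def rooted_path_def spoke_def)

lemma the_root_coalesced_paths: "the_root (coalesced_paths q m) = None"
  by (simp add: coalesced_paths_def coalesce_def)

lemma pverts_coalesced_paths: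
  "pverts (coalesced_paths q m) = {spoke i a | i a. i < q \<and> a \<le> m}"
proof -
  have "pverts (rooted_path (m + 1)) = {..m}" by (auto simp: rooted_path_def)
  then show ?thesis
    unfolding coalesced_paths_def coalesce_def coalesce_map_rooted_path by auto
qed

lemma spoke_in_coalesced_paths: "i < q \<Longrightarrow> a \<le> m \<Longrightarrow> spoke i a \<in> pverts (coalesced_paths q m)"
  by (auto simp: pverts_coalesced_paths)

lemma None_in_coalesced_paths: "q \<ge> 1 \<Longrightarrow> None \<in> pverts (coalesced_paths q m)"
  using spoke_in_coalesced_paths[of 0 q 0 m] by (simp add: spoke_0)

lemma coalesced_paths_cases:
  assumes "x \<in> pverts (coalesced_paths q m)"
  obtains i a where "x = spoke i a" "i < q" "a \<le> m"
  using assms by (auto simp: pverts_coalesced_paths)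

lemma parcs_coalesced_paths:
  "parcs (coalesced_paths q m) =
     {(spoke i a, spoke i b) | i a b. i < q \<and> a \<le> m \<and> b \<le> m \<and> (a = Suc b \<or> b = Suc a)}"
proof -
  have "parcs (rooted_path (m + 1)) = {(a, b). a \<le> m \<and> b \<le> m \<and> (a = Suc b \<or> b = Suc a)}"
    by (auto simp: rooted_path_def)
  then show ?thesis
    unfolding coalesced_paths_def coalesce_def coalesce_map_rooted_path by fastforce
qed

text \<open>The root lies on every path, so its coordinates do not determine the index; hence the
  alternatives \<open>a = 0\<close> and \<open>b = 0\<close> to \<open>i = j\<close>.\<close>

lemma parcs_coalesced_paths_iff:
  assumes "i < q" "j < q" "a \<le> m" "b \<le> m"
  shows "(spoke i a, spoke j b) \<in> parcs (coalesced_paths q m) \<longleftrightarrow>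
    (a = Suc b \<or> b = Suc a) \<and> (i = j \<or> a = 0 \<or> b = 0)"
  using assms by (fastforce simp: parcs_coalesced_paths spoke_eq_iff)

lemma pair_graph_coalesced_paths:
  "pair_graph (pair_pre_digraph.truncate (coalesced_paths q m))"
proof -
  have "pverts (coalesced_paths q m) \<subseteq> (\<lambda>(i, a). spoke i a) ` ({..<q} \<times> {..m})"
    by (auto elim!: coalesced_paths_cases)
  then have "finite (pverts (coalesced_paths q m))" by (rule finite_subset) simp
  then show ?thesis
    unfolding pair_graph_iff pair_pre_digraph.truncate_def pair_pre_digraph.simps
    by (auto simp: parcs_coalesced_paths spoke_eq_iff spoke_in_coalesced_paths
        intro!: symI irreflI)
qed

lemma rtrancl_coalesced_paths:
  "pverts (coalesced_paths q m) \<times> pverts (coalesced_paths q m) \<subseteq> (parcs (coalesced_paths q m))\<^sup>*"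
proof (rule rtrancl_all_pairsI)
  show "sym (parcs (coalesced_paths q m))"
    using pair_graph_coalesced_paths[of q m]
    by (simp add: pair_graph_iff pair_pre_digraph.truncate_def)
  have "a \<le> m \<Longrightarrow> (None, spoke i a) \<in> (parcs (coalesced_paths q m))\<^sup>*" if "i < q" for i a
  proof (induction a)
    case (Suc a)
    then have "(spoke i a, spoke i (Suc a)) \<in> parcs (coalesced_paths q m)"
      using that by (simp add: parcs_coalesced_paths_iff)
    with Suc show ?case by (meson Suc_leD rtrancl.rtrancl_into_rtrancl)
  qed (simp add: spoke_0)
  then show "(None, x) \<in> (parcs (coalesced_paths q m))\<^sup>*" if "x \<in> pverts (coalesced_paths q m)" for x
    using that by (auto elim!: coalesced_paths_cases)
qed

text \<open>Permuting the paths keeps the distance to the root, hence adjacency along each path, and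
  fixes the root.\<close>

lemma automorphism_coalesced_paths:
  assumes "bij_betw \<pi> {..<q} {..<q}"
  shows "automorphism (pair_pre_digraph.truncate (coalesced_paths q m))
    (map_option (map_prod \<pi> id))" (is "automorphism ?L ?\<psi>")
proof (rule automorphismI)
  have \<psi>: "?\<psi> (spoke i a) = spoke (\<pi> i) a" for i a by (simp add: spoke_def)
  have \<pi>: "\<pi> i < q" if "i < q" for i using bij_betwE[OF assms] that by simp
  have inj: "\<pi> i = \<pi> j \<longleftrightarrow> i = j" if "i < q" "j < q" for i j
    using assms that by (auto simp: bij_betw_def inj_on_eq_iff)
  show "finite (pverts ?L)" using pair_graph_coalesced_paths by (simp add: pair_graph_iff)
  show "?\<psi> ` pverts ?L \<subseteq> pverts ?L"
    using \<pi> by (auto simp: pair_pre_digraph.truncate_def \<psi> spoke_in_coalesced_paths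
        elim!: coalesced_paths_cases)
  show "inj_on ?\<psi> (pverts ?L)"
    using inj
    by (auto simp: pair_pre_digraph.truncate_def \<psi> spoke_eq_iff
        intro!: inj_onI elim!: coalesced_paths_cases)
  show "(?\<psi> u, ?\<psi> v) \<in> parcs ?L \<longleftrightarrow> (u, v) \<in> parcs ?L" if "u \<in> pverts ?L" "v \<in> pverts ?L" for u v
    using that \<pi> inj
    by (auto simp: pair_pre_digraph.truncate_def \<psi> parcs_coalesced_paths_iff
        elim!: coalesced_paths_cases)
qed

subsection \<open>Orbits of a vertex-transitive graph with attached paths\<close>

text \<open>The properties of a torus on which the orbit computation rests. The bounds on
  \<open>d\<close>, \<open>q\<close> and \<open>m\<close> give each root degree at least 3.\<close>

locale graph_with_spokes =
  fixes T :: "'a pair_pre_digraph" and d q m :: nat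
  assumes T: "pair_graph T" and T_nonempty: "pverts T \<noteq> {}"
    and T_connected: "pverts T \<times> pverts T \<subseteq> (parcs T)\<^sup>*"
    and T_transitive: "automorphically_similar T = pverts T \<times> pverts T"
    and T_regular: "\<And>v. v \<in> pverts T \<Longrightarrow> card {w. (v, w) \<in> parcs T} = d"
    and d: "d \<ge> 2" and q: "q \<ge> 1" and m: "m \<ge> 1"
begin

abbreviation L where "L \<equiv> coalesced_paths q m"
abbreviation G where "G \<equiv> T \<nabla> L"

definition level :: "nat \<Rightarrow> ('a \<times> (nat \<times> nat) option) set" where
  "level a = {u \<in> pverts G. depth (snd u) = a}"

lemmas pverts_G = pverts_attach_copies[of T L]
lemmas parcs_G = parcs_attach_copies[of _ _ _ _ T L, unfolded the_root_coalesced_paths]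

lemma pair_graph_G: "pair_graph G"
  using T pair_graph_coalesced_paths None_in_coalesced_paths[OF q]
  by (intro pair_graph_attach_copies) (simp_all add: the_root_coalesced_paths)

lemma connected_G: "connected_graph G"
proof (rule connected_graphI[OF pair_graph_G])
  show "pverts G \<noteq> {}"
    using T_nonempty None_in_coalesced_paths[OF q] by (auto simp: pverts_G)
  show "pverts G \<times> pverts G \<subseteq> (parcs G)\<^sup>*"
    using T_connected rtrancl_coalesced_paths None_in_coalesced_paths[OF q]
    by (intro rtrancl_attach_copies) (simp_all add: the_root_coalesced_paths)
qed

lemma card_pverts_G: "card (pverts G) = card (pverts T) * (1 + q * m)"
  using q by (simp add: pverts_G card_cartesian_product card_coalesced_paths)

lemma pverts_G_cases:
  assumes "u \<in> pverts G"
  obtains v i a where "u = (v, spoke i a)" "v \<in> pverts T" "i < q" "a \<le> m"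
  using assms by (auto simp: pverts_G elim!: coalesced_paths_cases)

lemma spoke_in_G: "v \<in> pverts T \<Longrightarrow> i < q \<Longrightarrow> a \<le> m \<Longrightarrow> (v, spoke i a) \<in> pverts G"
  by (simp add: pverts_G spoke_in_coalesced_paths)

lemma finite_neighbours_G: "finite {w. (u, w) \<in> parcs G}"
  using pair_graph_G finite_subset[of "{w. (u, w) \<in> parcs G}" "pverts G"]
  by (auto simp: pair_graph_iff)

section \<open>Automorphisms preserve depth\<close>

text \<open>The \<open>d\<close> neighbours in \<open>T\<close> and the first vertex of path 0 are
  \<open>d + 1\<close> distinct neighbours.\<close>

lemma card_neighbours_root:
  assumes v: "v \<in> pverts T"
  shows "card {w. ((v, None), w) \<in> parcs G} \<ge> 3"
proof -
  let ?N = "(\<lambda>w. (w, None :: (nat \<times> nat) option)) ` {w. (v, w) \<in> parcs T}" and ?s = "(v, spoke 0 1)"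
  have "(None, spoke 0 1) \<in> parcs L"
    using parcs_coalesced_paths_iff[of 0 q 0 0 m 1] q m by (simp add: spoke_0)
  then have sub: "insert ?s ?N \<subseteq> {w. ((v, None), w) \<in> parcs G}"
    using v by (auto simp: parcs_G)
  have "finite ?N" using finite_subset[OF sub finite_neighbours_G] by simp
  moreover have "card ?N = d" using T_regular[OF v] by (simp add: card_image inj_on_def)
  moreover have "?s \<notin> ?N" by (auto simp: spoke_def)
  ultimately have "card (insert ?s ?N) = Suc d" by simp
  with card_mono[OF finite_neighbours_G sub] d show ?thesis by simp
qed

text \<open>Only the two adjacent positions on the path are possible. The outer one is missing at
  the end of the path, hence an inequality.\<close>

lemma card_neighbours_nonroot:
  "card {w. ((v, spoke i (Suc a)), w) \<in> parcs G} \<le> 2"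
proof -
  have "{w. ((v, spoke i (Suc a)), w) \<in> parcs G} \<subseteq> {(v, spoke i a), (v, spoke i (Suc (Suc a)))}"
    by (auto simp: parcs_G parcs_coalesced_paths spoke_eq_iff) (auto simp: spoke_def)
  moreover have "card {(v, spoke i a), (v, spoke i (Suc (Suc a)))} = 2"
    by (simp add: spoke_eq_iff)
  ultimately show ?thesis by (metis card_mono finite.emptyI finite.insertI)
qed

lemma depth_adjacent: "(u, w) \<in> parcs G \<Longrightarrow> depth (snd w) \<le> Suc (depth (snd u))"
  by (cases u; cases w) (auto simp: parcs_G parcs_coalesced_paths)

text \<open>Induction on depth. Degrees show that roots go to roots; a vertex of depth
  \<open>n + 1\<close> has a neighbour of depth \<open>n\<close>, whose image has depth at most
  \<open>n\<close>, and an arc raises depth by at most one.\<close>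

lemma depth_automorphism_le:
  assumes \<phi>: "automorphism G \<phi>" and "u \<in> pverts G"
  shows "depth (snd (\<phi> u)) \<le> depth (snd u)"
  using assms(2)
proof (induction "depth (snd u)" arbitrary: u)
  case 0
  then obtain v where u: "u = (v, None)" "v \<in> pverts T"
    by (auto elim!: pverts_G_cases simp: spoke_0)
  have "\<phi> u \<in> pverts G" using \<phi> 0 by (auto simp: automorphism_def dest: bij_betwE)
  then obtain w i a where w: "\<phi> u = (w, spoke i a)" by (auto elim: pverts_G_cases)
  have "card {w. (\<phi> u, w) \<in> parcs G} \<ge> 3"
    using card_neighbours_automorphism[OF pair_graph_G \<phi> 0(2)] card_neighbours_root[OF u(2)] u
    by simp
  \<comment> \<open>If \<open>a\<close> were positive, it would be the successor of
    \<open>a - 1\<close> and the degree at most 2.\<close>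
  with w card_neighbours_nonroot[of w i "a - 1"] have "a = 0" by (cases a) auto
  with w show ?case by simp
next
  case (Suc n)
  then obtain v i where u: "u = (v, spoke i (Suc n))" "v \<in> pverts T" "i < q" "Suc n \<le> m"
    by (auto elim!: pverts_G_cases)
  \<comment> \<open>The neighbour of \<open>u\<close> one step closer to the root.\<close>
  let ?w = "(v, spoke i n)"
  have w: "?w \<in> pverts G" using u by (intro spoke_in_G) auto
  have "(?w, u) \<in> parcs G" using u by (simp add: parcs_G parcs_coalesced_paths_iff)
  then have "(\<phi> ?w, \<phi> u) \<in> parcs G" using \<phi> w Suc.prems by (auto simp: automorphism_def)
  then show ?case using Suc.hyps(1)[of ?w] w u by (auto dest!: depth_adjacent)
qed

text \<open>The reverse inequality is the previous one for the inverse automorphism.\<close>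

lemma depth_automorphism:
  assumes \<phi>: "automorphism G \<phi>" and u: "u \<in> pverts G"
  shows "depth (snd (\<phi> u)) = depth (snd u)"
proof (rule antisym)
  have b: "bij_betw \<phi> (pverts G) (pverts G)" using \<phi> by (simp add: automorphism_def)
  then have "\<phi> u \<in> pverts G" using u by (auto dest: bij_betwE)
  from depth_automorphism_le[OF automorphism_inv_into[OF \<phi>] this]
  show "depth (snd u) \<le> depth (snd (\<phi> u))" using bij_betw_inv_into_left[OF b u] by simp
qed (rule depth_automorphism_le[OF assms])

section \<open>The orbits are the levels\<close>

lemma automorphically_similar_G:
  "automorphically_similar G =
     {(u, w). u \<in> pverts G \<and> w \<in> pverts G \<and> depth (snd u) = depth (snd w)}"
proof -
  have "\<exists>\<phi>. automorphism G \<phi> \<and> \<phi> u = w"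
    if uw: "u \<in> pverts G" "w \<in> pverts G" "depth (snd u) = depth (snd w)" for u w
  proof -
    obtain x i a where u: "u = (x, spoke i a)" "x \<in> pverts T" "i < q" "a \<le> m"
      using uw(1) by (rule pverts_G_cases)
    obtain y j b where w: "w = (y, spoke j b)" "y \<in> pverts T" "j < q" "b \<le> m"
      using uw(2) by (rule pverts_G_cases)
    have "(x, y) \<in> automorphically_similar T" using T_transitive u w by simp
    then obtain f where f: "automorphism T f" "f x = y" by (auto simp: automorphically_similar_def)
    \<comment> \<open>Swapping paths \<open>i\<close> and \<open>j\<close> moves
      \<open>spoke i a\<close> to \<open>spoke j a\<close>, while \<open>f\<close> moves the base
      vertex \<open>x\<close> to \<open>y\<close>.\<close>
    let ?\<pi> = "Transposition.transpose i j"
    let ?\<psi> = "map_option (map_prod ?\<pi> id)"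
    have "?\<pi> ` {..<q} = {..<q}" using u w by (intro transpose_image_eq) auto
    then have "bij_betw ?\<pi> {..<q} {..<q}" by (simp add: bij_betw_def)
    then have "automorphism G (map_prod f ?\<psi>)"
      using f None_in_coalesced_paths[OF q] automorphism_coalesced_paths
      by (intro automorphism_attach_copies) (simp_all add: the_root_coalesced_paths)
    moreover have "a = b" using u w uw(3) by simp
    then have "map_prod f ?\<psi> u = w" using f u w by (simp add: spoke_def)
    ultimately show ?thesis by blast
  qed
  then show ?thesis
    by (auto simp: automorphically_similar_def) (metis depth_automorphism snd_conv)
qed

lemma orbits_G: "orbits G = level ` {..m}"
proof -
  have cls: "automorphically_similar G `` {u} = level (depth (snd u))" if "u \<in> pverts G" for u
    using that by (auto simp: automorphically_similar_G level_def)
  have "orbits G = (\<lambda>u. level (depth (snd u))) ` pverts G"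
    unfolding orbits_def quotient_def using cls by auto
  also have "\<dots> = level ` (\<lambda>u. depth (snd u)) ` pverts G" by (simp add: image_image)
  also have "(\<lambda>u. depth (snd u)) ` pverts G = {..m}"
  proof (intro equalityI subsetI)
    \<comment> \<open>Every depth up to \<open>m\<close> occurs on path 0, which exists because
      \<open>q \<ge> 1\<close>.\<close>
    fix a assume "a \<in> {..m}"
    moreover obtain v where "v \<in> pverts T" using T_nonempty by blast
    ultimately have "(v, spoke 0 a) \<in> pverts G" using q by (intro spoke_in_G) auto
    then show "a \<in> (\<lambda>u. depth (snd u)) ` pverts G" by force
  qed (auto elim!: pverts_G_cases)
  finally show ?thesis .
qed

lemma spoke_in_level: "v \<in> pverts T \<Longrightarrow> i < q \<Longrightarrow> a \<le> m \<Longrightarrow> (v, spoke i a) \<in> level a"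
  by (simp add: level_def spoke_in_G)

text \<open>Each level is nonempty and its elements determine the depth.\<close>

lemma inj_on_level: "inj_on level {..m}"
proof (rule inj_onI)
  fix a b assume ab: "a \<in> {..m}" "b \<in> {..m}" "level a = level b"
  obtain v where "v \<in> pverts T" using T_nonempty by blast
  then have "(v, spoke 0 a) \<in> level a" using ab q by (intro spoke_in_level) auto
  with ab show "a = b" by (simp add: level_def)
qed

lemma orbit_ordering_G: "orbit_ordering G (map level [0..<Suc m])"
  using inj_on_level
  by (simp add: orbit_ordering_def orbits_G distinct_map atLeast0LessThan lessThan_Suc_atMost
      del: upt_Suc)

section \<open>The orbit divisor matrix\<close>

text \<open>The right-hand side mentions \<open>T\<close> only through its degree \<open>d\<close>.
  This is what makes the matrices of different tori equal.\<close>

lemma orbit_degree_G: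
  assumes "a \<le> m" "b \<le> m"
  shows "orbit_degree G (level a) (level b) =
    (if a = 0 \<and> b = 0 then d else card {y. depth y = b \<and> (spoke 0 a, y) \<in> parcs L})"
proof -
  obtain v where v: "v \<in> pverts T" using T_nonempty by blast
  have LV: "x \<in> pverts L \<and> y \<in> pverts L" if "(x, y) \<in> parcs L" for x y
    using that pair_graph_coalesced_paths[of q m]
    by (auto simp: pair_graph_iff pair_pre_digraph.truncate_def)
  have TV: "w \<in> pverts T" if "(v, w) \<in> parcs T" for w
    using that T by (auto simp: pair_graph_iff)
  have "orbit_degree G (level a) (level b) = card {w \<in> level b. ((v, spoke 0 a), w) \<in> parcs G}"
    using assms v q by (intro orbit_degree_eq spoke_in_level) (auto simp: orbits_G)
  also have "\<dots> = (if a = 0 \<and> b = 0 then d else card {y. depth y = b \<and> (spoke 0 a, y) \<in> parcs L})"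
  proof (cases "a = 0 \<and> b = 0")
    case True
    have "{w \<in> level b. ((v, spoke 0 a), w) \<in> parcs G} = (\<lambda>w. (w, None)) ` {w. (v, w) \<in> parcs T}"
      using True v TV None_in_coalesced_paths[OF q]
      by (auto simp: level_def pverts_G parcs_G spoke_0 parcs_coalesced_paths spoke_def depth_def)
    moreover have "inj_on (\<lambda>w. (w, None :: (nat \<times> nat) option)) {w. (v, w) \<in> parcs T}" by (simp add: inj_on_def)
    ultimately show ?thesis using True T_regular[OF v] by (simp add: card_image)
  next
    case False
    \<comment> \<open>Arcs of \<open>T\<close> join level 0 to itself, so for any other pair of
      levels all neighbours lie in the copy at \<open>v\<close>.\<close>
    have "{w \<in> level b. ((v, spoke 0 a), w) \<in> parcs G} =
        Pair v ` {y. depth y = b \<and> (spoke 0 a, y) \<in> parcs L}"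
      using False v LV
      by (auto simp: level_def pverts_G parcs_G) (auto simp: spoke_def depth_def split: if_splits)
    then show ?thesis unfolding if_not_P[OF False] by (simp add: card_image inj_on_def)
  qed
  finally show ?thesis .
qed

lemma orbit_divisor_matrix_G:
  "orbit_divisor_matrix G (map level [0..<Suc m]) = mat (Suc m) (Suc m)
    (\<lambda>(a, b). if a = 0 \<and> b = 0 then d else card {y. depth y = b \<and> (spoke 0 a, y) \<in> parcs L})"
  unfolding orbit_divisor_matrix_def
  by (rule eq_matI) (auto simp: orbit_degree_G simp del: upt_Suc)

lemma card_orbits_G: "card (orbits G) = Suc m"
  using inj_on_level by (simp add: orbits_G card_image)

end

section \<open>Sequences of tori with attached paths\<close>

theorem theorem2:
  fixes q m r :: nat and s :: "nat \<Rightarrow> nat list"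
  assumes "q \<ge> 1" and "m \<ge> 1" and "r \<ge> 1"
    and "\<And>k. k \<ge> 1 \<Longrightarrow> length (s k) = r"
    and "\<And>k n. k \<ge> 1 \<Longrightarrow> n \<in> set (s k) \<Longrightarrow> n \<ge> 3"
    and "strict_mono_on {1..} (\<lambda>k. prod_list (s k))"
  shows "self_similar (\<lambda>k. torus (s k) \<nabla> coalesced_paths q m)"
proof -
  \<comment> \<open>Each of the \<open>r\<close> cycles contributes 2 to the degree, so the
    parameters are the same for all \<open>k\<close>.\<close>
  have spokes: "graph_with_spokes (torus (s k)) (r * 2) q m" if k: "k \<ge> 1" for k
  proof (rule graph_with_spokes.intro)
    have s: "n \<ge> 3" if "n \<in> set (s k)" for n using assms(5) k that by blast
    show "pair_graph (torus (s k))" by (rule pair_graph_torus) (rule s)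
    show "pverts (torus (s k)) \<times> pverts (torus (s k)) \<subseteq> (parcs (torus (s k)))\<^sup>*"
      by (rule rtrancl_torus) (rule s)
    show "automorphically_similar (torus (s k)) = pverts (torus (s k)) \<times> pverts (torus (s k))"
      by (rule vertex_transitive_torus) (rule s)
    have "0 \<notin> set (s k)" using s[of 0] by auto
    then have "card (pverts (torus (s k))) \<noteq> 0" by (simp add: card_pverts_torus prod_list_zero_iff)
    then show "pverts (torus (s k)) \<noteq> {}" by auto
    show "card {w. (v, w) \<in> parcs (torus (s k))} = r * 2" if "v \<in> pverts (torus (s k))" for v
      using card_neighbours_torus[OF s that] assms(4)[OF k] by simp
  qed (use assms in simp_all)
  show ?thesis unfolding self_similar_def
  proof (intro conjI allI impI)
    show "connected_graph (torus (s k) \<nabla> coalesced_paths q m)" if "1 \<le> k" for k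
      using graph_with_spokes.connected_G[OF spokes[OF that]] .
    show "strict_mono_on {1..} (\<lambda>k. card (pverts (torus (s k) \<nabla> coalesced_paths q m)))"
    proof (rule strict_mono_onI)
      fix i j :: nat assume ij: "i \<in> {1..}" "j \<in> {1..}" "i < j"
      then have "prod_list (s i) < prod_list (s j)"
        by (rule strict_mono_onD[OF assms(6)])
      then have "prod_list (s i) * (1 + q * m) < prod_list (s j) * (1 + q * m)"
        by (rule mult_strict_right_mono) simp
      with ij show "card (pverts (torus (s i) \<nabla> coalesced_paths q m))
          < card (pverts (torus (s j) \<nabla> coalesced_paths q m))"
        by (simp only: atLeast_iff graph_with_spokes.card_pverts_G[OF spokes] card_pverts_torus)
    qed
    fix i j :: nat assume "1 \<le> i" "1 \<le> j" "i \<noteq> j"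
    \<comment> \<open>Both instances have the same parameters, so their divisor matrices, with
      levels in increasing order, equal the same explicit matrix.\<close>
    then interpret I: graph_with_spokes "torus (s i)" "r * 2" q m
      + J: graph_with_spokes "torus (s j)" "r * 2" q m
      by (simp_all add: spokes)
    show "orbitally_similar (torus (s i) \<nabla> coalesced_paths q m) (torus (s j) \<nabla> coalesced_paths q m)"
      unfolding orbitally_similar_def
      using I.card_orbits_G J.card_orbits_G I.orbit_ordering_G J.orbit_ordering_G
        I.orbit_divisor_matrix_G J.orbit_divisor_matrix_G by metis
  qed
qed

end
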